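(* Let $k$ be a perfect field of characteristic $p>0$, let $e\geq 1$ and $n\geq 2$ be integers, let $g\in k[T]$ satisfy $g(0)=0$, and define the polynomial map $$\Psi_{g,e,n}(X_1,\ldots,X_n)=\bigl(X_1+(X_2\,g(X_1))^{p^e},X_2,\ldots,X_n\bigr).$$ Let $L$ be a perfect field containing $k$. Then the Jacobian matrix of $\Psi_{g,e,n}$ is the identity matrix $I_n$. Moreover, the following conditions are equivalent: (1) the induced map $\Psi_{g,e,n}\colon L^n\to L^n$ is injective; (2) the induced map $\Psi_{g,e,n}\colon L^n\to L^n$ is the identity; (3) $g(s)=0$ for every $s\in L$. If $L=\mathbf{F}_{q^m}$ (with $q$ a power of $p$ and $m\ge 1$) and $g\in\mathbf{F}_q[T]$, these conditions are also equivalent to $$T^{q^m}-T\mid g(T).$$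
   Context: The Jacobian matrix of a polynomial map $F=(F_1,\ldots,F_n)$ is the matrix of formal partial derivatives $(\partial F_i/\partial X_j)_{i,j}$. $\mathbf{F}_q$ denotes the finite field with $q$ elements. *)

theory Defs
  imports
    "HOL-Library.Poly_Mapping"
    "HOL-Computational_Algebra.Polynomial"
    "Jordan_Normal_Form.Matrix"
begin

definition perfect_field :: "'a::field itself \<Rightarrow> bool" where
  "perfect_field _ \<longleftrightarrow> CHAR('a) = 0 \<or> (\<forall>x::'a. \<exists>y. y ^ CHAR('a) = x)"

text \<open>
  A polynomial is a finitely supported map from monomials to coefficients, and a monomial is a
  finitely supported map from variable indices to exponents. Indices start at 0, as for
  vectors and matrices: \<open>mvar 0\<close> is the variable \<open>X_1\<close> of the usual notation and
  \<open>mvar 1\<close> is \<open>X_2\<close>. A polynomial map in \<open>n\<close> variables is a vector of dimension \<open>n\<close>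
  of polynomials that involve only the variables with index below \<open>n\<close>.
\<close>

type_synonym 'a mpoly = "(nat \<Rightarrow>\<^sub>0 nat) \<Rightarrow>\<^sub>0 'a"

definition mconst :: "'a::comm_ring_1 \<Rightarrow> 'a mpoly" where
  "mconst c = Poly_Mapping.single 0 c"

definition mvar :: "nat \<Rightarrow> 'a::comm_ring_1 mpoly" where
  "mvar i = Poly_Mapping.single (Poly_Mapping.single i 1) 1"

text \<open>
  Subtraction of monomials is truncated, but this has no effect below: if the variable \<open>j\<close> does
  not occur in \<open>a\<close>, the coefficient of the summand is 0.
\<close>

definition partial_deriv :: "nat \<Rightarrow> 'a::comm_ring_1 mpoly \<Rightarrow> 'a mpoly" where
  "partial_deriv j P =
     (\<Sum>a\<in>Poly_Mapping.keys P.
        Poly_Mapping.single (a - Poly_Mapping.single j 1)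
          (of_nat (Poly_Mapping.lookup a j) * Poly_Mapping.lookup P a))"

definition jacobian_matrix :: "'a::comm_ring_1 mpoly vec \<Rightarrow> 'a mpoly mat" where
  "jacobian_matrix F = mat (dim_vec F) (dim_vec F) (\<lambda>(i, j). partial_deriv j (F $ i))"

text \<open>Evaluation at a point with coordinates in an extension, given by the embedding \<open>\<phi>\<close>.\<close>

definition mpoly_eval :: "('a::comm_ring_1 \<Rightarrow> 'b::comm_ring_1) \<Rightarrow> 'a mpoly \<Rightarrow> 'b vec \<Rightarrow> 'b" where
  "mpoly_eval \<phi> P x =
     (\<Sum>a\<in>Poly_Mapping.keys P.
        \<phi> (Poly_Mapping.lookup P a) *
        (\<Prod>i\<in>Poly_Mapping.keys a. (x $ i) ^ Poly_Mapping.lookup a i))"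

definition induced_map ::
    "('a::comm_ring_1 \<Rightarrow> 'b::comm_ring_1) \<Rightarrow> 'a mpoly vec \<Rightarrow> 'b vec \<Rightarrow> 'b vec" where
  "induced_map \<phi> F x = map_vec (\<lambda>P. mpoly_eval \<phi> P x) F"

text \<open>\<open>poly (map_poly mconst g) (mvar 0)\<close> is \<open>g\<close> with the first variable substituted for its
  indeterminate.\<close>

definition Psi :: "nat \<Rightarrow> 'a::comm_ring_1 poly \<Rightarrow> nat \<Rightarrow> nat \<Rightarrow> 'a mpoly vec" where
  "Psi p g e n = vec n (\<lambda>i.
     if i = 0 then mvar 0 + (mvar 1 * poly (map_poly mconst g) (mvar 0)) ^ (p ^ e)
     else mvar i)"

end

theory Submission
  imports Defs "Jordan_Normal_Form.Char_Poly"
begin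

(* The Jacobian matrix does not see p-th powers, since D (P^p) = p P^(p-1) D P = 0. On points,
   the first coordinate is shifted by (y g(s))^(p^e), and since L is perfect, y can be chosen
   such that this power is any prescribed value as soon as g(s) is nonzero. Choosing the value
   -s makes (s, y) collide with (0, y), which is fixed because g(0) = 0.
   If L has N elements, they are exactly the roots of T^N - T, so the remainder of g modulo
   T^N - T vanishes on L iff it is zero, having degree less than N. *)

section \<open>Polynomial mappings\<close>

text \<open>Each finitely supported map is a sum of maps supported at one point. An identity that is
  additive in a polynomial therefore only has to be checked on monomials, as is done twice below for
  products.\<close>

lemma poly_mapping_add_induct [case_names zero single add]:
  fixes f :: "'a \<Rightarrow>\<^sub>0 'b::monoid_add"
  assumes "P 0" and "\<And>a b. P (Poly_Mapping.single a b)"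
    and "\<And>f g. P f \<Longrightarrow> P g \<Longrightarrow> P (f + g)"
  shows "P f"
proof (induction f rule: update_induct)
  case const
  show ?case by fact
next
  case (update f a b)
  \<comment> \<open>The key \<open>a\<close> is new to \<open>f\<close>, so overwriting the value 0
    there amounts to adding \<open>b\<close>.\<close>
  have "Poly_Mapping.update a b f = f + Poly_Mapping.single a b"
    using update(1) by (intro poly_mapping_eqI)
      (auto simp: lookup_update lookup_add lookup_single in_keys_iff)
  then show ?case using assms(2,3) update(3) by simp
qed

section \<open>Formal partial derivatives\<close>

lemma partial_deriv_zero [simp]: "partial_deriv j 0 = 0"
  by (simp add: partial_deriv_def)

lemma partial_deriv_single:
  "partial_deriv j (Poly_Mapping.single a c) =
     Poly_Mapping.single (a - Poly_Mapping.single j 1) (of_nat (Poly_Mapping.lookup a j) * c)"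
  by (cases "c = 0") (simp_all add: partial_deriv_def)

lemma partial_deriv_add:
  "partial_deriv j (P + Q) = partial_deriv j P + partial_deriv j Q"
  unfolding partial_deriv_def
  by (rule setsum_keys_plus_distrib) (simp_all add: distrib_left single_add)

lemma partial_deriv_mult_single:
  fixes c d :: "'a::comm_ring_1"
  shows "partial_deriv j (Poly_Mapping.single a c * Poly_Mapping.single b d) =
     partial_deriv j (Poly_Mapping.single a c) * Poly_Mapping.single b d +
     Poly_Mapping.single a c * partial_deriv j (Poly_Mapping.single b d)"
proof -
  let ?e = "Poly_Mapping.single j (1::nat)"
  \<comment> \<open>If \<open>j\<close> occurs in \<open>a\<close>, the subtraction is not truncated
    and commutes with adding \<open>b\<close>. If it does not, the factor
    \<open>Poly_Mapping.lookup a j\<close> makes both sides of \<open>left\<close> zero;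
    \<open>right\<close> is symmetric.\<close>
  have shift: "a + b - ?e = (a - ?e) + b" if "Poly_Mapping.lookup a j \<noteq> 0"
    for a b :: "nat \<Rightarrow>\<^sub>0 nat"
    using that by (intro poly_mapping_eqI)
      (auto simp: lookup_add lookup_minus lookup_single when_def)
  have left: "Poly_Mapping.single (a + b - ?e) (of_nat (Poly_Mapping.lookup a j) * (c * d)) =
      Poly_Mapping.single ((a - ?e) + b) (of_nat (Poly_Mapping.lookup a j) * c * d)"
    by (cases "Poly_Mapping.lookup a j = 0") (simp_all add: shift mult.assoc del: One_nat_def)
  have right: "Poly_Mapping.single (a + b - ?e) (of_nat (Poly_Mapping.lookup b j) * (c * d)) =
      Poly_Mapping.single (a + (b - ?e)) (c * (of_nat (Poly_Mapping.lookup b j) * d))"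
    by (cases "Poly_Mapping.lookup b j = 0")
      (simp_all add: shift[of b a] add.commute[of a] mult.left_commute del: One_nat_def)
  show ?thesis
    by (simp add: partial_deriv_single mult_single lookup_add distrib_right single_add left right
        del: One_nat_def)
qed

lemma partial_deriv_mult:
  "partial_deriv j (P * Q) = partial_deriv j P * Q + P * partial_deriv j Q"
proof (induction P rule: poly_mapping_add_induct)
  case (single a c)
  show ?case
    by (induction Q rule: poly_mapping_add_induct)
      (simp_all add: partial_deriv_mult_single partial_deriv_add algebra_simps)
qed (simp_all add: partial_deriv_add algebra_simps)

lemma partial_deriv_one [simp]: "partial_deriv j 1 = 0"
  by (simp add: partial_deriv_single flip: single_one)

lemma partial_deriv_power:
  "partial_deriv j (P ^ m) = of_nat m * P ^ (m - 1) * partial_deriv j P"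
proof (induction m)
  case (Suc m)
  then show ?case
    by (cases m) (simp_all add: partial_deriv_mult algebra_simps)
qed simp

lemma partial_deriv_power_CHAR:
  fixes P :: "'a::comm_ring_1 mpoly"
  assumes "CHAR('a) dvd m"
  shows "partial_deriv j (P ^ m) = 0"
proof -
  \<comment> \<open>An integer is a constant polynomial, so it vanishes once it vanishes in the
    coefficient ring.\<close>
  have "(of_nat m :: 'a mpoly) = 0"
    using assms by (metis of_nat_eq_0_iff_char_dvd single_of_nat single_zero)
  then show ?thesis
    by (simp add: partial_deriv_power)
qed

lemma partial_deriv_mvar: "partial_deriv j (mvar i) = (if i = j then 1 else 0)"
  by (simp add: mvar_def partial_deriv_single lookup_single)

section \<open>Evaluation\<close>

context comm_ring_hom
begin

lemma mpoly_eval_single: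
  "mpoly_eval hom (Poly_Mapping.single a c) x =
     hom c * (\<Prod>i\<in>Poly_Mapping.keys a. (x $ i) ^ Poly_Mapping.lookup a i)"
  by (cases "c = 0") (simp_all add: mpoly_eval_def)

text \<open>The extra factors have exponent 0. With one index set for two monomials and their
  product, the evaluations can be compared factor by factor.\<close>

lemma mpoly_eval_single_superset:
  assumes "finite A" "Poly_Mapping.keys a \<subseteq> A"
  shows "mpoly_eval hom (Poly_Mapping.single a c) x =
    hom c * (\<Prod>i\<in>A. (x $ i) ^ Poly_Mapping.lookup a i)"
proof -
  have "(\<Prod>i\<in>Poly_Mapping.keys a. (x $ i) ^ Poly_Mapping.lookup a i) =
      (\<Prod>i\<in>A. (x $ i) ^ Poly_Mapping.lookup a i)"
    using assms by (intro prod.mono_neutral_left) (auto simp: in_keys_iff)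
  then show ?thesis
    by (simp add: mpoly_eval_single)
qed

lemma mpoly_eval_add: "mpoly_eval hom (P + Q) x = mpoly_eval hom P x + mpoly_eval hom Q x"
  unfolding mpoly_eval_def
  by (rule setsum_keys_plus_distrib) (simp_all add: hom_add distrib_right)

lemma mpoly_eval_mult_single:
  "mpoly_eval hom (Poly_Mapping.single a c * Poly_Mapping.single b d) x =
     mpoly_eval hom (Poly_Mapping.single a c) x * mpoly_eval hom (Poly_Mapping.single b d) x"
proof -
  let ?A = "Poly_Mapping.keys a \<union> Poly_Mapping.keys b"
  have "Poly_Mapping.keys (a + b) \<subseteq> ?A"
    by (rule keys_add)
  then show ?thesis
    by (simp add: mult_single mpoly_eval_single_superset[where A = ?A] lookup_add power_add
        prod.distrib hom_mult mult_ac)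
qed

lemma mpoly_eval_mult: "mpoly_eval hom (P * Q) x = mpoly_eval hom P x * mpoly_eval hom Q x"
proof (induction P rule: poly_mapping_add_induct)
  case (single a c)
  show ?case
  proof (induction Q rule: poly_mapping_add_induct)
    case (single b d)
    show ?case by (rule mpoly_eval_mult_single)
  qed (simp_all add: mpoly_eval_def[of _ 0] mpoly_eval_add distrib_left)
qed (simp_all add: mpoly_eval_def[of _ 0] mpoly_eval_add distrib_right)

lemma mpoly_eval_mconst: "mpoly_eval hom (mconst c) x = hom c"
  by (simp add: mconst_def mpoly_eval_single)

lemma mpoly_eval_mvar: "mpoly_eval hom (mvar i) x = x $ i"
  by (simp add: mvar_def mpoly_eval_single)

lemma comm_ring_hom_mpoly_eval: "comm_ring_hom (\<lambda>P. mpoly_eval hom P x)"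
proof
  show "mpoly_eval hom 0 x = 0"
    by (simp add: mpoly_eval_def)
  show "mpoly_eval hom 1 x = 1"
    by (simp add: mpoly_eval_single flip: single_one)
qed (simp_all add: mpoly_eval_add mpoly_eval_mult)

text \<open>Evaluation is a ring homomorphism and so passes through Horner's scheme for
  \<open>g\<close>. Taking \<open>P\<close> to be \<open>mvar 0\<close> evaluates the factor g(X_1)
  of \<open>Psi\<close>.\<close>

lemma mpoly_eval_poly_mconst:
  "mpoly_eval hom (poly (map_poly mconst g) P) x = poly (map_poly hom g) (mpoly_eval hom P x)"
proof -
  interpret ev: comm_ring_hom "\<lambda>P. mpoly_eval hom P x"
    by (rule comm_ring_hom_mpoly_eval)
  have "mconst (0::'a) = 0"
    by (simp add: mconst_def)
  then show ?thesis
    by (induction g)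
      (simp_all add: Polynomial.map_poly_pCons mpoly_eval_add mpoly_eval_mult mpoly_eval_mconst
        map_poly_pCons_hom ev.hom_zero)
qed

lemma induced_map_Psi:
  assumes "x \<in> carrier_vec n"
  shows "induced_map hom (Psi p g e n) x =
    vec n (\<lambda>i. if i = 0 then x $ 0 + (x $ 1 * poly (map_poly hom g) (x $ 0)) ^ (p ^ e) else x $ i)"
proof -
  interpret ev: comm_ring_hom "\<lambda>P. mpoly_eval hom P x"
    by (rule comm_ring_hom_mpoly_eval)
  show ?thesis
    by (intro eq_vecI)
      (auto simp: induced_map_def Psi_def mpoly_eval_add ev.hom_power mpoly_eval_mult
        mpoly_eval_poly_mconst mpoly_eval_mvar simp del: One_nat_def)
qed

end

lemma jacobian_matrix_Psi:
  fixes g :: "'a::comm_ring_1 poly"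
  assumes "CHAR('a) dvd p ^ e"
  shows "jacobian_matrix (Psi p g e n) = 1\<^sub>m n"
  using assms by (intro eq_matI)
    (auto simp: jacobian_matrix_def Psi_def partial_deriv_add partial_deriv_power_CHAR
      partial_deriv_mvar)

section \<open>Injectivity over a perfect field\<close>

text \<open>Take p-th roots \<open>e\<close> times; positive characteristic excludes the first
  alternative in \<open>perfect_field\<close>.\<close>

lemma perfect_field_CHAR_power_root:
  assumes "perfect_field TYPE('a::field)" and "CHAR('a) > 0"
  shows "\<exists>y::'a. y ^ (CHAR('a) ^ e) = x"
proof (induction e arbitrary: x)
  case (Suc e)
  obtain z :: 'a where "z ^ CHAR('a) = x"
    using assms unfolding perfect_field_def by fastforce
  moreover obtain y where "y ^ (CHAR('a) ^ e) = z"
    using Suc by blast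
  ultimately have "y ^ (CHAR('a) ^ Suc e) = x"
    by (simp only: power_Suc2 power_mult)
  then show ?case ..
qed simp

context field_hom
begin

text \<open>A field embedding is injective, so the same integers vanish in both fields and the
  characteristics divide each other.\<close>

lemma CHAR_hom: "CHAR('b) = CHAR('a)"
proof -
  have zero_iff: "(of_nat m :: 'b) = 0 \<longleftrightarrow> (of_nat m :: 'a) = 0" for m
    using hom_0_iff[of "of_nat m"] by (simp only: hom_of_nat)
  show ?thesis
    by (rule dvd_antisym) (metis zero_iff of_nat_CHAR of_nat_eq_0_iff_char_dvd)+
qed

lemma induced_map_Psi_eq_id_iff:
  assumes "n \<ge> 2" and "p > 0"
  shows "(\<forall>x\<in>carrier_vec n. induced_map hom (Psi p g e n) x = x) \<longleftrightarrow>
    (\<forall>s. poly (map_poly hom g) s = 0)"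
proof
  assume id: "\<forall>x\<in>carrier_vec n. induced_map hom (Psi p g e n) x = x"
  show "\<forall>s. poly (map_poly hom g) s = 0"
  proof
    fix s :: 'b
    \<comment> \<open>With second coordinate 1 the shift is g(s)^(p^e), which is 0 only if g(s)
      is.\<close>
    define x where "x = vec n (\<lambda>i. if i = 0 then s else 1)"
    have "x \<in> carrier_vec n"
      by (simp add: x_def)
    then have "induced_map hom (Psi p g e n) x $ 0 = x $ 0"
      using id by simp
    then show "poly (map_poly hom g) s = 0"
      using assms \<open>x \<in> carrier_vec n\<close> by (simp add: induced_map_Psi x_def)
  qed
next
  assume "\<forall>s. poly (map_poly hom g) s = 0"
  then show "\<forall>x\<in>carrier_vec n. induced_map hom (Psi p g e n) x = x"
    using assms by (auto simp: induced_map_Psi intro!: eq_vecI)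
qed

lemma inj_on_induced_map_Psi_imp_vanishing:
  assumes perfect: "perfect_field TYPE('b)" and char: "CHAR('b) = p" "p > 0"
    and n: "n \<ge> 2" and g0: "poly g 0 = 0"
    and inj: "inj_on (induced_map hom (Psi p g e n)) (carrier_vec n)"
  shows "poly (map_poly hom g) s = 0"
proof (rule ccontr)
  let ?g = "poly (map_poly hom g)"
  assume nz: "?g s \<noteq> 0"
  have g0': "?g 0 = 0"
    using g0 by simp
  obtain z where z: "z ^ (p ^ e) = - s"
    using perfect_field_CHAR_power_root[OF perfect, of e "- s"] char by auto
  \<comment> \<open>The two points to collide agree after the first coordinate. At
    \<open>pt s\<close> the shift is z^(p^e) = -s, so the first coordinate becomes 0; at
    \<open>pt 0\<close> the shift is 0 because g(0) = 0.\<close>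
  define pt where "pt t = vec n (\<lambda>i. if i = 0 then t else z / ?g s)" for t
  have carrier: "pt t \<in> carrier_vec n" for t
    by (simp add: pt_def)
  have "induced_map hom (Psi p g e n) (pt s) = induced_map hom (Psi p g e n) (pt 0)"
    unfolding induced_map_Psi[OF carrier] using n nz z g0' char
    by (intro eq_vecI) (auto simp: pt_def)
  then have "pt s = pt 0"
    using inj carrier by (auto dest: inj_onD)
  then have "pt s $ 0 = pt 0 $ 0"
    by simp
  then have "s = 0"
    using n by (simp add: pt_def)
  then show False
    using nz g0' by simp
qed

end

section \<open>Vanishing on a finite field\<close>

text \<open>The library proves this for types of class \<open>finite_field\<close>, but finiteness assumed as a
  hypothesis cannot provide the class for a type variable.\<close>
lemma finite_field_power_card:
  fixes x :: "'a::field"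
  assumes "finite (UNIV :: 'a set)"
  shows "x ^ card (UNIV :: 'a set) = x"
proof (cases "x = 0")
  case False
  let ?U = "UNIV - {0 :: 'a}"
  \<comment> \<open>Multiplication by a nonzero \<open>x\<close> permutes the nonzero elements;
    cancelling their product leaves x^(N-1) = 1, where N is the size of the field.\<close>
  have "bij_betw ((*) x) ?U ?U"
    using False by (intro bij_betw_byWitness[where f' = "\<lambda>y. y / x"]) auto
  then have "(\<Prod>y\<in>?U. x * y) = \<Prod>?U"
    by (rule prod.reindex_bij_betw[where g = "\<lambda>y. y"])
  then have "x ^ card ?U * \<Prod>?U = \<Prod>?U"
    by (simp add: prod.distrib)
  moreover have "\<Prod>?U \<noteq> 0"
    using assms by simp
  ultimately have "x ^ card ?U = 1"
    by simp
  moreover have "card (UNIV :: 'a set) = Suc (card ?U)"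
    by (rule card.remove[OF assms]) simp
  ultimately show ?thesis by (simp only: power_Suc mult_1_right)
qed (use assms finite_UNIV_card_ge_0 in auto)

lemma degree_monom_diff_monom:
  assumes "N > 1"
  shows "degree (monom 1 N - monom 1 1 :: 'a::comm_ring_1 poly) = N"
  using assms unfolding diff_conv_add_uminus
  by (subst degree_add_eq_left) (simp_all add: degree_monom_eq)

lemma (in field_hom) vanishing_iff_dvd:
  assumes fin: "finite (UNIV :: 'b set)" and N: "card (UNIV :: 'b set) = N"
  shows "(\<forall>s. poly (map_poly hom h) s = 0) \<longleftrightarrow> monom 1 N - monom 1 1 dvd h"
proof
  interpret mp: map_poly_comm_ring_hom hom ..
  let ?f = "monom 1 N - monom 1 1 :: 'a poly"
  have f0: "poly (map_poly hom ?f) s = 0" for s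
    using finite_field_power_card[OF fin, of s] N by (simp add: mp.hom_minus poly_monom)
  show "\<forall>s. poly (map_poly hom h) s = 0" if dvd: "?f dvd h"
    using dvd f0 by (auto elim!: dvdE simp: mp.hom_mult)
  assume van: "\<forall>s. poly (map_poly hom h) s = 0"
  \<comment> \<open>Since 0 and 1 differ, T^N is not cancelled by T, and \<open>?f\<close> has
    degree \<open>N\<close>.\<close>
  have "N > 1"
    using card_mono[OF fin, of "{0, 1}"] N by simp
  then have deg: "degree ?f = N"
    by (rule degree_monom_diff_monom)
  \<comment> \<open>The division takes place over the smaller field \<open>'a\<close>; its embedding
    carries the identity to \<open>'b\<close>, where the roots lie.\<close>
  have "poly (map_poly hom (h div ?f * ?f + h mod ?f)) s = 0" for s
    using van by (simp only: div_mult_mod_eq)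
  then have roots: "poly (map_poly hom (h mod ?f)) s = 0" for s
    using f0 by (simp add: mp.hom_add mp.hom_mult)
  have "map_poly hom (h mod ?f) = 0"
  proof (rule ccontr)
    assume nz: "map_poly hom (h mod ?f) \<noteq> 0"
    then have "N \<le> degree (map_poly hom (h mod ?f))"
      using card_poly_roots_bound[OF nz] roots N by simp
    moreover have "degree (h mod ?f) < degree ?f"
      using nz deg \<open>N > 1\<close> by (intro degree_mod_less') auto
    ultimately show False
      using deg by simp
  qed
  \<comment> \<open>The embedding is injective on coefficients.\<close>
  then have "h mod ?f = 0"
    by (simp add: poly_eq_iff)
  then show "?f dvd h"
    by (simp add: dvd_eq_mod_eq_0)
qed

text \<open>The fields F_q and L are types of the given cardinalities. That g lies in F_q[T] is
  expressed by a polynomial \<open>h\<close> over F_q having the same image as \<open>g\<close> in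
  L[T]; the divisibility is then a statement about \<open>h\<close>.\<close>

theorem theorem3p3:
  fixes p e n :: nat
    and g :: "'k::field poly"
    and \<phi> :: "'k \<Rightarrow> 'l::field"
  assumes "p > 0" and "CHAR('k) = p" and "perfect_field TYPE('k)"
    and "e \<ge> 1" and "n \<ge> 2"
    and "poly g 0 = 0"
    and "perfect_field TYPE('l)" and "field_hom \<phi>"
  shows "jacobian_matrix (Psi p g e n) = 1\<^sub>m n
    \<and> (inj_on (induced_map \<phi> (Psi p g e n)) (carrier_vec n)
         \<longleftrightarrow> (\<forall>x\<in>carrier_vec n. induced_map \<phi> (Psi p g e n) x = x))
    \<and> ((\<forall>x\<in>carrier_vec n. induced_map \<phi> (Psi p g e n) x = x)
         \<longleftrightarrow> (\<forall>s. poly (map_poly \<phi> g) s = 0))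
    \<and> (\<forall>(q::nat) (m::nat) (\<psi>::'f::field \<Rightarrow> 'l) (h::'f poly).
         (\<exists>r\<ge>1. q = p ^ r) \<and> m \<ge> 1
         \<and> finite (UNIV::'f set) \<and> card (UNIV::'f set) = q
         \<and> finite (UNIV::'l set) \<and> card (UNIV::'l set) = q ^ m
         \<and> field_hom \<psi> \<and> map_poly \<psi> h = map_poly \<phi> g
         \<longrightarrow> ((\<forall>s. poly (map_poly \<phi> g) s = 0)
              \<longleftrightarrow> monom 1 (q ^ m) - monom 1 1 dvd h))"
proof (intro conjI allI impI)
  interpret field_hom \<phi> by fact
  \<comment> \<open>The characteristic \<open>p\<close> divides \<open>p ^ e\<close> because
    \<open>e\<close> is at least 1.\<close>
  show "jacobian_matrix (Psi p g e n) = 1\<^sub>m n"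
    using assms by (intro jacobian_matrix_Psi) (simp add: dvd_power)
  show id_iff: "(\<forall>x\<in>carrier_vec n. induced_map \<phi> (Psi p g e n) x = x) \<longleftrightarrow>
      (\<forall>s. poly (map_poly \<phi> g) s = 0)"
    using assms by (intro induced_map_Psi_eq_id_iff)
  show "inj_on (induced_map \<phi> (Psi p g e n)) (carrier_vec n) \<longleftrightarrow>
      (\<forall>x\<in>carrier_vec n. induced_map \<phi> (Psi p g e n) x = x)"
  proof
    assume "inj_on (induced_map \<phi> (Psi p g e n)) (carrier_vec n)"
    then show "\<forall>x\<in>carrier_vec n. induced_map \<phi> (Psi p g e n) x = x"
      unfolding id_iff using assms CHAR_hom
      by (intro allI inj_on_induced_map_Psi_imp_vanishing) auto
  next
    assume "\<forall>x\<in>carrier_vec n. induced_map \<phi> (Psi p g e n) x = x"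
    then show "inj_on (induced_map \<phi> (Psi p g e n)) (carrier_vec n)"
      by (simp add: inj_on_def)
  qed
next
  fix q m :: nat and \<psi> :: "'f \<Rightarrow> 'l" and h :: "'f poly"
  assume "(\<exists>r\<ge>1. q = p ^ r) \<and> m \<ge> 1
    \<and> finite (UNIV::'f set) \<and> card (UNIV::'f set) = q
    \<and> finite (UNIV::'l set) \<and> card (UNIV::'l set) = q ^ m
    \<and> field_hom \<psi> \<and> map_poly \<psi> h = map_poly \<phi> g"
  \<comment> \<open>The criterion is applied to \<open>\<psi>\<close> and \<open>h\<close>, whose
    image in L[T] is that of \<open>g\<close>.\<close>
  then show "(\<forall>s. poly (map_poly \<phi> g) s = 0) \<longleftrightarrow> monom 1 (q ^ m) - monom 1 1 dvd h"
    using field_hom.vanishing_iff_dvd[of \<psi> "q ^ m" h] by simp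
qed

end
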